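(* Let $n, r, k$ be positive integers with $r\le n$ and $k\ge 2$. Let $\kappa,\bar\kappa\in\mathbb{R}$ with $\kappa\neq 0$. For $j=2,\dots,k$ and $i=1,\dots,k$ let $\alpha_j,\alpha_{j,i}\in\mathbb{R}$ be constants such that, for each $j$, the numbers $\alpha_j,\alpha_{j,1},\dots,\alpha_{j,k}$ are not all zero. Let $\mathbf D=\mathbf D^\top\in\mathbb{R}^{n\times n}$ be the symmetric matrix of the lifted full-order model $$\dot{\mathbf q}=\mathbf p,\qquad \dot{\mathbf p}=\mathbf D\mathbf q-\bar\kappa\,\mathbf w_1\odot\mathbf w_2,\qquad \dot{\mathbf w}_1=\tfrac{\kappa^2\bar\kappa}{2}\,\mathbf w_2\odot\mathbf p,\qquad \dot{\mathbf w}_j=\Big(\alpha_j\mathbf q+\sum_{i=1}^k\alpha_{j,i}\mathbf w_i\Big)\odot\mathbf p\quad (j=2,\dots,k),$$ with states $\mathbf q,\mathbf p,\mathbf w_1,\dots,\mathbf w_k\in\mathbb{R}^n$, and let $$E_{\mathrm{lift}}(\mathbf q,\mathbf p,\mathbf w_1,\dots,\mathbf w_k)=\tfrac12\mathbf p^\top\mathbf p-\tfrac12\mathbf q^\top\mathbf D\mathbf q+\tfrac1{\kappa^2}\mathbf w_1^\top\mathbf w_1 .$$ Let $\mathbf\Phi,\mathbf V_1,\dots,\mathbf V_k\in\mathbb{R}^{n\times r}$ be basis matrices with orthonormal columns, let $\widehat{\mathbf D}=\widehat{\mathbf D}^\top\in\mathbb{R}^{r\times r}$, and let $\widehat{\mathbf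 H}_{\mathbf p},\widehat{\mathbf H}_{\mathbf w_1},\widehat{\mathbf H}_{\mathbf w_j},\widehat{\mathbf H}_{\mathbf w_{j,i}}\in\mathbb{R}^{r\times r^2}$ ($j=2,\dots,k$, $i=1,\dots,k$) be the reduced quadratic operators defined in the context. Consider the structure-preserving Lift & Learn reduced-order model for $\widehat{\mathbf q},\widehat{\mathbf p},\widehat{\mathbf w}_1,\dots,\widehat{\mathbf w}_k\in\mathbb{R}^r$: $$\dot{\widehat{\mathbf q}}=\widehat{\mathbf p},\qquad \dot{\widehat{\mathbf p}}=\widehat{\mathbf D}\widehat{\mathbf q}+\widehat{\mathbf H}_{\mathbf p}(\widehat{\mathbf w}_1\otimes\widehat{\mathbf w}_2),\qquad \dot{\widehat{\mathbf w}}_1=\widehat{\mathbf H}_{\mathbf w_1}(\widehat{\mathbf w}_2\otimes\widehat{\mathbf p}),$$ $$\dot{\widehat{\mathbf w}}_j=\widehat{\mathbf H}_{\mathbf w_j}(\widehat{\mathbf q}\otimes\widehat{\mathbf p})+\sum_{i=1}^k\widehat{\mathbf H}_{\mathbf w_{j,i}}(\widehat{\mathbf w}_i\otimes\widehat{\mathbf p})\qquad (j=2,\dots,k).$$ Then this reduced-order model conserves the perturbed lifted energy $$\widehat E_{\mathrm{lift}}(\widehat{\mathbf q},\widehat{\mathbf p},\widehat{\mathbf w}_1,\dots,\widehat{\mathbf w}_k):=E_{\mathrm{lift}}(\mathbf\Phi\widehat{\mathbf q},\mathbf\Phi\widehat{\mathbf p},\mathbf V_1\widehat{\mathbf w}_1,\dots,\mathbf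 V_k\widehat{\mathbf w}_k)+\Delta E_{\mathrm{lift}}(\widehat{\mathbf q}),\qquad \Delta E_{\mathrm{lift}}(\widehat{\mathbf q})=\tfrac12\widehat{\mathbf q}^\top(\mathbf\Phi^\top\mathbf D\mathbf\Phi-\widehat{\mathbf D})\widehat{\mathbf q}.$$ That is, along every solution $(\widehat{\mathbf q}(t),\widehat{\mathbf p}(t),\widehat{\mathbf w}_1(t),\dots,\widehat{\mathbf w}_k(t))$ of the reduced-order model, $\widehat E_{\mathrm{lift}}$ is constant in time.
   Context: Notation: $\odot$ is the component-wise (Hadamard) product of vectors in $\mathbb{R}^n$; $\otimes$ is the Kronecker product (of vectors or matrices). Full-order quadratic operators: $\mathbf H_{\mathbf p},\mathbf H_{\mathbf w_1},\mathbf H_{\mathbf w_j},\mathbf H_{\mathbf w_{j,i}}\in\mathbb{R}^{n\times n^2}$ are the matrices that represent the Hadamard products of the lifted full-order model as Kronecker products, i.e. for all $\mathbf u,\mathbf v\in\mathbb{R}^n$, $$\mathbf H_{\mathbf p}(\mathbf u\otimes\mathbf v)=-\bar\kappa\,\mathbf u\odot\mathbf v,\quad \mathbf H_{\mathbf w_1}(\mathbf u\otimes\mathbf v)=\tfrac{\kappa^2\bar\kappa}{2}\,\mathbf u\odot\mathbf v,\quad \mathbf H_{\mathbf w_j}(\mathbf u\otimes\mathbf v)=\alpha_j\,\mathbf u\odot\mathbf v,\quad \mathbf H_{\mathbf w_{j,i}}(\mathbf u\otimes\mathbf v)=\alpha_{j,i}\,\mathbf u\odot\mathbf v .$$ Reduced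 quadratic operators, for $j=2,\dots,k$ and $i=1,\dots,k$: $$\widehat{\mathbf H}_{\mathbf p}=\mathbf\Phi^\top\mathbf H_{\mathbf p}(\mathbf V_1\otimes\mathbf V_2),\quad \widehat{\mathbf H}_{\mathbf w_1}=\mathbf V_1^\top\mathbf H_{\mathbf w_1}(\mathbf V_2\otimes\mathbf\Phi),\quad \widehat{\mathbf H}_{\mathbf w_j}=\mathbf V_j^\top\mathbf H_{\mathbf w_j}(\mathbf\Phi\otimes\mathbf\Phi),\quad \widehat{\mathbf H}_{\mathbf w_{j,i}}=\mathbf V_j^\top\mathbf H_{\mathbf w_{j,i}}(\mathbf V_i\otimes\mathbf\Phi).$$ Origin of the data: $\mathbf D$ is a symmetric discrete Laplacian. The columns of $\mathbf\Phi$ are leading left singular vectors of a snapshot matrix $[\mathbf Q,\mathbf P]$ of $\mathbf q$ and $\mathbf p$ (proper symplectic decomposition via the cotangent lift algorithm), and the columns of $\mathbf V_i$ are leading left singular vectors of a snapshot matrix of $\mathbf w_i$ (proper orthogonal decomposition), so $\mathbf\Phi^\top\mathbf\Phi=\mathbf V_i^\top\mathbf V_i=\mathbf I_r$. The matrix $\widehat{\mathbf D}$ is learned from projected snapshot data by a least-squares problem constrained to symmetric $r\times r$ matrices; in general $\widehat{\mathbf D}\ne\mathbf\Phi^\top\mathbf D\mathbf\Phi$. *)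

theory Defs
  imports "HOL-Analysis.Analysis"
begin

text \<open>
  The $n^2$ coordinates are indexed by the product type \<open>'n \<times> 'n\<close>, so that the
  Kronecker product does not depend on an enumeration of index pairs.
\<close>

abbreviation hadamard :: "real^'n \<Rightarrow> real^'n \<Rightarrow> real^'n"  (infixl "\<odot>" 70)
  where "u \<odot> v \<equiv> u * v"  \<comment> \<open>multiplication on vectors is component-wise in the library\<close>

definition kron_vec :: "real^'m \<Rightarrow> real^'n \<Rightarrow> real^('m \<times> 'n)"  (infixl "\<otimes>\<^sub>v" 70)
  where "u \<otimes>\<^sub>v v = (\<chi> ab. u $ fst ab * v $ snd ab)"

definition kron_mat :: "real^'c^'m \<Rightarrow> real^'d^'n \<Rightarrow> real^('c \<times> 'd)^('m \<times> 'n)"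
    (infixl "\<otimes>\<^sub>m" 75)
  where "A \<otimes>\<^sub>m B = (\<chi> ab cd. A $ fst ab $ fst cd * B $ snd ab $ snd cd)"

definition represents_hadamard :: "real^('n \<times> 'n)^'n \<Rightarrow> real \<Rightarrow> bool"
  where "represents_hadamard H c \<longleftrightarrow> (\<forall>u v. H *v (u \<otimes>\<^sub>v v) = c *\<^sub>R (u \<odot> v))"

lemma represents_hadamard_iff:
  fixes H :: "real^('n \<times> 'n)^'n"
  shows "represents_hadamard H c \<longleftrightarrow>
     H = (\<chi> a bd. if fst bd = a \<and> snd bd = a then c else 0)"
proof
  assume H: "represents_hadamard H c"
  have "H $ a $ (b, d) = (if b = a \<and> d = a then c else 0)" for a b d
  proof -
    have e: "axis b (1::real) \<otimes>\<^sub>v axis d 1 = axis (b, d) 1"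
      by (auto simp: kron_vec_def vec_eq_iff axis_def)
    have "(H *v axis (b, d) 1) $ a = (c *\<^sub>R (axis b 1 \<odot> axis d 1)) $ a"
      using H e unfolding represents_hadamard_def by metis
    moreover have "(H *v axis (b, d) 1) $ a = H $ a $ (b, d)"
      by (simp add: matrix_vector_mult_basis column_def)
    ultimately show ?thesis
      by (auto simp: axis_def)
  qed
  then show "H = (\<chi> a bd. if fst bd = a \<and> snd bd = a then c else 0)"
    by (auto simp: vec_eq_iff)
next
  assume H: "H = (\<chi> a bd. if fst bd = a \<and> snd bd = a then c else 0)"
  have "(\<Sum>x\<in>UNIV. (if fst x = a \<and> snd x = a then c else 0) * (u $ fst x * v $ snd x))
      = c * (u $ a * v $ a)" for a and u v :: "real^'n"
  proof -
    have "(\<Sum>x\<in>UNIV. (if fst x = a \<and> snd x = a then c else 0) * (u $ fst x * v $ snd x))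
        = (\<Sum>x\<in>UNIV. if x = (a, a) then c * (u $ a * v $ a) else 0)"
      by (intro sum.cong) (auto simp: prod_eq_iff)
    then show ?thesis by simp
  qed
  then show "represents_hadamard H c"
    by (simp add: represents_hadamard_def H kron_vec_def vec_eq_iff matrix_vector_mult_def)
qed

definition orthonormal_columns :: "real^'r^'n \<Rightarrow> bool"
  where "orthonormal_columns V \<longleftrightarrow> transpose V ** V = mat 1"

text \<open>
  In the following, a family \<open>w\<close> stands for the tuple of auxiliary states \<open>w 1, \<dots>, w k\<close>;
  other indices are irrelevant.
\<close>

definition E_lift :: "real \<Rightarrow> real^'n^'n \<Rightarrow> real^'n \<Rightarrow> real^'n \<Rightarrow> (nat \<Rightarrow> real^'n) \<Rightarrow> real"
  where "E_lift \<kappa> D q p w =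
    1/2 * (p \<bullet> p) - 1/2 * (q \<bullet> (D *v q)) + 1/\<kappa>\<^sup>2 * (w 1 \<bullet> w 1)"

definition Delta_E_lift :: "real^'n^'n \<Rightarrow> real^'r^'r \<Rightarrow> real^'r^'n \<Rightarrow> real^'r \<Rightarrow> real"
  where "Delta_E_lift D Dh \<Phi> q = 1/2 * (q \<bullet> ((transpose \<Phi> ** D ** \<Phi> - Dh) *v q))"

definition perturbed_E_lift ::
  "real \<Rightarrow> real^'n^'n \<Rightarrow> real^'r^'r \<Rightarrow> real^'r^'n \<Rightarrow> (nat \<Rightarrow> real^'r^'n) \<Rightarrow>
   real^'r \<Rightarrow> real^'r \<Rightarrow> (nat \<Rightarrow> real^'r) \<Rightarrow> real"
  where "perturbed_E_lift \<kappa> D Dh \<Phi> V q p w =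
    E_lift \<kappa> D (\<Phi> *v q) (\<Phi> *v p) (\<lambda>i. V i *v w i) + Delta_E_lift D Dh \<Phi> q"

text \<open>
  Solutions on a time set \<open>T\<close> (meant to be an interval); derivatives are taken within \<open>T\<close>,
  hence one-sided at endpoints belonging to \<open>T\<close>.
\<close>

definition rom_solution ::
  "real set \<Rightarrow> nat \<Rightarrow> real^'r^'r \<Rightarrow> real^('r \<times> 'r)^'r \<Rightarrow> real^('r \<times> 'r)^'r \<Rightarrow>
   (nat \<Rightarrow> real^('r \<times> 'r)^'r) \<Rightarrow> (nat \<Rightarrow> nat \<Rightarrow> real^('r \<times> 'r)^'r) \<Rightarrow>
   (real \<Rightarrow> real^'r) \<Rightarrow> (real \<Rightarrow> real^'r) \<Rightarrow> (nat \<Rightarrow> real \<Rightarrow> real^'r) \<Rightarrow> bool"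
  where "rom_solution T k Dh Hhp Hhw1 Hhw Hhwi q p w \<longleftrightarrow>
    (\<forall>t\<in>T.
      (q has_vector_derivative p t) (at t within T) \<and>
      (p has_vector_derivative (Dh *v q t + Hhp *v (w 1 t \<otimes>\<^sub>v w 2 t))) (at t within T) \<and>
      (w 1 has_vector_derivative (Hhw1 *v (w 2 t \<otimes>\<^sub>v p t))) (at t within T) \<and>
      (\<forall>j\<in>{2..k}. (w j has_vector_derivative
          (Hhw j *v (q t \<otimes>\<^sub>v p t) + (\<Sum>i=1..k. Hhwi j i *v (w i t \<otimes>\<^sub>v p t)))) (at t within T)))"

end

theory Submission
  imports Defs
begin

text \<open>
  Since \<open>\<Phi>\<close> and \<open>V 1\<close> have orthonormal columns, the perturbation exactly replaces \<open>D\<close> by \<open>Dh\<close>: the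
  perturbed energy is \<open>p \<bullet> p / 2 - q \<bullet> (Dh *v q) / 2 + (w 1 \<bullet> w 1) / \<kappa>\<^sup>2\<close> in reduced coordinates.
  Along a solution the \<open>Dh\<close> terms cancel by symmetry. Lifting the quadratic terms to the full space
  turns their contributions into \<open>-\<kappa>bar\<close> and \<open>\<kappa>bar\<close> times the same totally symmetric trilinear form
  \<open>\<Sum>\<^sub>a x\<^sub>a y\<^sub>a z\<^sub>a\<close>, evaluated at \<open>\<Phi> *v p\<close>, \<open>V 1 *v w 1\<close>, \<open>V 2 *v w 2\<close>.
\<close>

text \<open>Mixed-product rule: each coordinate on the left is a sum over index pairs, which factors
  into a product of two single sums.\<close>

lemma kron_mat_vec_mult:
  "(A \<otimes>\<^sub>m B) *v (u \<otimes>\<^sub>v v) = (A *v u) \<otimes>\<^sub>v (B *v v)"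
  by (simp add: kron_mat_def kron_vec_def matrix_vector_mult_def vec_eq_iff sum_product
      sum.cartesian_product case_prod_beta mult_ac flip: UNIV_Times_UNIV)

lemma inner_transpose_mult:
  fixes A :: "real^'r^'n"
  shows "x \<bullet> (transpose A *v y) = (A *v x) \<bullet> y"
  by (simp add: dot_lmul_matrix flip: vector_transpose_matrix)

text \<open>The transpose of \<open>U\<close> moves across the inner product as an adjoint, and the
  mixed-product rule turns the argument of \<open>H\<close> into a Kronecker product of lifted
  vectors, where \<open>H\<close> acts as a scaled Hadamard product.\<close>

lemma inner_reduced_hadamard:
  assumes "represents_hadamard H c"
  shows "x \<bullet> ((transpose U ** H ** (A \<otimes>\<^sub>m B)) *v (u \<otimes>\<^sub>v v))
    = c * ((U *v x) \<bullet> ((A *v u) \<odot> (B *v v)))"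
  using assms
  by (simp add: represents_hadamard_def kron_mat_vec_mult inner_transpose_mult
      del: transpose_matrix_vector flip: matrix_vector_mul_assoc)

lemma inner_hadamard_rotate:
  fixes x y z :: "real^'n"
  shows "x \<bullet> (y \<odot> z) = y \<bullet> (z \<odot> x)"
  by (simp add: inner_vec_def mult_ac)

lemma orthonormal_columns_inner:
  assumes "orthonormal_columns V"
  shows "(V *v x) \<bullet> (V *v y) = x \<bullet> y"
  using assms
  by (simp add: orthonormal_columns_def matrix_vector_mul_assoc flip: inner_transpose_mult)

lemma perturbed_E_lift_eq:
  assumes "orthonormal_columns \<Phi>" and "orthonormal_columns (V 1)"
  shows "perturbed_E_lift \<kappa> D Dh \<Phi> V q p w
    = 1/2 * (p \<bullet> p) - 1/2 * (q \<bullet> (Dh *v q)) + 1/\<kappa>\<^sup>2 * (w 1 \<bullet> w 1)"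
proof -
  \<comment> \<open>This matches the first half of the perturbation with the lifted potential term,
    so the two cancel.\<close>
  have "q \<bullet> ((transpose \<Phi> ** D ** \<Phi>) *v q) = (\<Phi> *v q) \<bullet> (D *v (\<Phi> *v q))"
    by (simp add: inner_transpose_mult del: transpose_matrix_vector
        flip: matrix_vector_mul_assoc)
  then show ?thesis
    using assms
    by (simp add: perturbed_E_lift_def E_lift_def Delta_E_lift_def orthonormal_columns_inner
        matrix_vector_mult_diff_rdistrib inner_diff_right algebra_simps)
qed

lemma has_vector_derivative_inner:
  fixes f g :: "real \<Rightarrow> 'a::real_inner"
  assumes "(f has_vector_derivative f') (at t within T)"
    and "(g has_vector_derivative g') (at t within T)"
  shows "((\<lambda>t. f t \<bullet> g t) has_vector_derivative (f t \<bullet> g' + f' \<bullet> g t)) (at t within T)"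
  using bounded_bilinear.has_vector_derivative[OF bounded_bilinear_inner assms] .

theorem proposition1:
  fixes k :: nat and \<kappa> \<kappa>bar :: real
    and \<alpha> :: "nat \<Rightarrow> real" and \<alpha>' :: "nat \<Rightarrow> nat \<Rightarrow> real"
    and D :: "real^'n^'n" and Dh :: "real^'r^'r"
    and \<Phi> :: "real^'r^'n" and V :: "nat \<Rightarrow> real^'r^'n"
    and Hp Hw1 :: "real^('n \<times> 'n)^'n"
    and Hw :: "nat \<Rightarrow> real^('n \<times> 'n)^'n" and Hwi :: "nat \<Rightarrow> nat \<Rightarrow> real^('n \<times> 'n)^'n"
    and Hhp Hhw1 :: "real^('r \<times> 'r)^'r"
    and Hhw :: "nat \<Rightarrow> real^('r \<times> 'r)^'r" and Hhwi :: "nat \<Rightarrow> nat \<Rightarrow> real^('r \<times> 'r)^'r"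
    and T :: "real set"
    and q p :: "real \<Rightarrow> real^'r" and w :: "nat \<Rightarrow> real \<Rightarrow> real^'r"
  assumes "CARD('r) \<le> CARD('n)" and "k \<ge> 2" and "\<kappa> \<noteq> 0"
    and "\<forall>j\<in>{2..k}. \<not> (\<alpha> j = 0 \<and> (\<forall>i\<in>{1..k}. \<alpha>' j i = 0))"
    and "transpose D = D" and "transpose Dh = Dh"
    and "orthonormal_columns \<Phi>" and "\<forall>i\<in>{1..k}. orthonormal_columns (V i)"
    and "represents_hadamard Hp (- \<kappa>bar)"
    and "represents_hadamard Hw1 (\<kappa>\<^sup>2 * \<kappa>bar / 2)"
    and "\<forall>j\<in>{2..k}. represents_hadamard (Hw j) (\<alpha> j)"
    and "\<forall>j\<in>{2..k}. \<forall>i\<in>{1..k}. represents_hadamard (Hwi j i) (\<alpha>' j i)"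
    and "Hhp = transpose \<Phi> ** Hp ** (V 1 \<otimes>\<^sub>m V 2)"
    and "Hhw1 = transpose (V 1) ** Hw1 ** (V 2 \<otimes>\<^sub>m \<Phi>)"
    and "\<forall>j\<in>{2..k}. Hhw j = transpose (V j) ** Hw j ** (\<Phi> \<otimes>\<^sub>m \<Phi>)"
    and "\<forall>j\<in>{2..k}. \<forall>i\<in>{1..k}. Hhwi j i = transpose (V j) ** Hwi j i ** (V i \<otimes>\<^sub>m \<Phi>)"
    and "is_interval T"
    and "rom_solution T k Dh Hhp Hhw1 Hhw Hhwi q p w"
  shows "(\<lambda>t. perturbed_E_lift \<kappa> D Dh \<Phi> V (q t) (p t) (\<lambda>i. w i t)) constant_on T"
proof -
  let ?E = "\<lambda>t. 1/2 * (p t \<bullet> p t) - 1/2 * (q t \<bullet> (Dh *v q t)) + 1/\<kappa>\<^sup>2 * (w 1 t \<bullet> w 1 t)"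
  have "(?E has_vector_derivative 0) (at t within T)" if "t \<in> T" for t
  proof -
    note sol = assms(18)[unfolded rom_solution_def, rule_format, OF that]
    \<comment> \<open>\<open>p'\<close> is only the quadratic part of the derivative of
      \<open>p\<close>, whereas \<open>w1'\<close> is the whole derivative of
      \<open>w 1\<close>.\<close>
    define p' w1' where "p' = Hhp *v (w 1 t \<otimes>\<^sub>v w 2 t)" and "w1' = Hhw1 *v (w 2 t \<otimes>\<^sub>v p t)"
    have dq: "(q has_vector_derivative p t) (at t within T)"
      and dp: "(p has_vector_derivative (Dh *v q t + p')) (at t within T)"
      and dw: "(w 1 has_vector_derivative w1') (at t within T)"
      using sol by (simp_all add: p'_def w1'_def)
    have dDq: "((\<lambda>t. Dh *v q t) has_vector_derivative Dh *v p t) (at t within T)"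
      using bounded_linear.has_vector_derivative[OF matrix_vector_mul_bounded_linear dq] .
    have sym: "q t \<bullet> (Dh *v p t) = p t \<bullet> (Dh *v q t)"
      using inner_transpose_mult[of "q t" Dh "p t"] assms(6) by (simp add: inner_commute)
    have p': "p t \<bullet> p' = - \<kappa>bar * ((\<Phi> *v p t) \<bullet> ((V 1 *v w 1 t) \<odot> (V 2 *v w 2 t)))"
      unfolding p'_def assms(13) by (rule inner_reduced_hadamard[OF assms(9)])
    have "w 1 t \<bullet> w1' = \<kappa>\<^sup>2 * \<kappa>bar / 2 * ((V 1 *v w 1 t) \<bullet> ((V 2 *v w 2 t) \<odot> (\<Phi> *v p t)))"
      unfolding w1'_def assms(14) by (rule inner_reduced_hadamard[OF assms(10)])
    \<comment> \<open>The factor 2 comes from differentiating \<open>w 1 t \<bullet> w 1 t\<close>.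
      The weight \<open>2 / \<kappa>\<^sup>2\<close> reduces the coefficient
      \<open>\<kappa>\<^sup>2 * \<kappa>bar / 2\<close> to \<open>\<kappa>bar\<close>, and one
      rotation aligns the trilinear forms.\<close>
    then have cancel: "p t \<bullet> p' + 2 / \<kappa>\<^sup>2 * (w 1 t \<bullet> w1') = 0"
      using \<open>\<kappa> \<noteq> 0\<close> inner_hadamard_rotate[of "\<Phi> *v p t"]
      by (simp add: p' field_simps)
    have "(?E has_vector_derivative
        1/2 * (p t \<bullet> (Dh *v q t + p') + (Dh *v q t + p') \<bullet> p t)
        - 1/2 * (q t \<bullet> (Dh *v p t) + p t \<bullet> (Dh *v q t))
        + 1/\<kappa>\<^sup>2 * (w 1 t \<bullet> w1' + w1' \<bullet> w 1 t)) (at t within T)"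
      by (intro has_vector_derivative_add has_vector_derivative_diff
          has_vector_derivative_mult_right has_vector_derivative_inner dq dp dw dDq)
    also have "1/2 * (p t \<bullet> (Dh *v q t + p') + (Dh *v q t + p') \<bullet> p t)
        - 1/2 * (q t \<bullet> (Dh *v p t) + p t \<bullet> (Dh *v q t))
        + 1/\<kappa>\<^sup>2 * (w 1 t \<bullet> w1' + w1' \<bullet> w 1 t) = p t \<bullet> p' + 2 / \<kappa>\<^sup>2 * (w 1 t \<bullet> w1')"
      by (simp add: sym inner_add_left inner_add_right inner_commute add_divide_distrib)
    finally show ?thesis
      unfolding cancel .
  qed
  \<comment> \<open>An interval is convex, so a zero derivative within \<open>T\<close> yields one
    constant on all of \<open>T\<close>, endpoints included.\<close>
  then obtain c where "\<And>t. t \<in> T \<Longrightarrow> ?E t = c"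
    using has_vector_derivative_zero_constant[of T ?E] is_interval_convex[OF assms(17)] by blast
  moreover have "orthonormal_columns (V 1)"
    using assms(2,8) by simp
  ultimately show ?thesis
    using assms(7) by (auto simp: constant_on_def perturbed_E_lift_eq)
qed

end
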